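(* Let $1\le r\le n$ be integers and let $f:\mathbb R^{n\times n}\to\mathbb R$ be twice continuously differentiable. Let $M^*\in\mathbb R^{n\times n}$ be a symmetric positive semidefinite matrix with $\operatorname{rank}(M^* )\le r$ that is a global minimizer of $f$ over $\mathbb R^{n\times n}$. Let $0<\epsilon\le 2(\sqrt 2-1)$ and assume that $f$ satisfies the $\delta$-$\mathrm{RIP}_{2r}$ property for some constant $\delta\in[0,1)$ such that $$\delta<\sqrt{1-\frac{3+2\sqrt 2}{4}\epsilon^2}.$$ Then the problem $\min_{X\in\mathbb R^{n\times r}} f(XX^T)$ has no spurious local minimizer $X$ that satisfies $$\|XX^T-M^*\|_F\le\epsilon\,\lambda_r(M^* ),$$ i.e., every local minimizer $X\in\mathbb R^{n\times r}$ of $X\mapsto f(XX^T)$ satisfying this inequality is a global minimizer of it.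
   Context: For $M\in\mathbb R^{n\times n}$ the Hessian $\nabla^2 f(M)$ is regarded as the bilinear (quadratic) form $[\nabla^2 f(M)](K,L)=\sum_{i,j,k,l=1}^n \frac{\partial^2 f}{\partial M_{ij}\partial M_{kl}}(M)K_{ij}L_{kl}$ for $K,L\in\mathbb R^{n\times n}$. $\|\cdot\|_F$ is the Frobenius norm, and $\lambda_1(A)\ge\dots\ge\lambda_n(A)$ are the eigenvalues of a symmetric matrix $A\in\mathbb R^{n\times n}$ in decreasing order. $\delta$-$\mathrm{RIP}_{2r}$ (for $\delta\in[0,1)$): $(1-\delta)\|K\|_F^2\le[\nabla^2 f(M)](K,K)\le(1+\delta)\|K\|_F^2$ for all $M,K\in\mathbb R^{n\times n}$ with $\operatorname{rank}(M)\le 2r$ and $\operatorname{rank}(K)\le 2r$. A spurious local minimizer is a local minimizer that is not a global minimizer. *)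

theory Defs
  imports "HOL-Analysis.Analysis" "HOL-Computational_Algebra.Polynomial"
    "HOL-Library.Multiset"
begin

text \<open>The library \<^const>\<open>norm\<close> on \<^typ>\<open>real^'n^'m\<close> is the Frobenius norm.\<close>

lemma norm_matrix_eq_frobenius:
  fixes A :: "real^'n^'m"
  shows "norm A = sqrt (\<Sum>i\<in>UNIV. \<Sum>j\<in>UNIV. (A $ i $ j)\<^sup>2)"
  by (simp add: norm_vec_def L2_set_def sum_nonneg)

definition psd_matrix :: "real^'n^'n \<Rightarrow> bool" where
  "psd_matrix A \<longleftrightarrow> transpose A = A \<and> (\<forall>x. 0 \<le> x \<bullet> (A *v x))"

definition charpoly :: "real^'n^'n \<Rightarrow> real poly" where
  "charpoly A = det (mat [:0, 1:] - map_matrix (\<lambda>a. [:a:]) A)"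

text \<open>The \<open>k\<close>-th largest eigenvalue \<open>\<lambda>\<^sub>k(A)\<close> (\<open>k\<close> counted from 1), where eigenvalues are
  repeated according to their multiplicity as roots of the characteristic polynomial. Only real
  roots are listed, so this is meant for symmetric \<open>A\<close> and \<open>1 \<le> k \<le> n\<close>.\<close>

definition eigenvalue_desc :: "real^'n^'n \<Rightarrow> nat \<Rightarrow> real" where
  "eigenvalue_desc A k = rev (sorted_list_of_multiset (proots (charpoly A))) ! (k - 1)"

definition twice_continuously_differentiable :: "('a::real_normed_vector \<Rightarrow> real) \<Rightarrow> bool" where
  "twice_continuously_differentiable f \<longleftrightarrow>
     (\<exists>(f' :: 'a \<Rightarrow> 'a \<Rightarrow>\<^sub>L real) (f'' :: 'a \<Rightarrow> 'a \<Rightarrow>\<^sub>L 'a \<Rightarrow>\<^sub>L real).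
        (\<forall>x. (f has_derivative blinfun_apply (f' x)) (at x)) \<and>
        (\<forall>x. (f' has_derivative blinfun_apply (f'' x)) (at x)) \<and>
        continuous_on UNIV f'')"

text \<open>\<^term>\<open>axis i (axis j 1)\<close> is the matrix unit with entry 1 at position \<open>(i, j)\<close>.\<close>

definition entry_deriv :: "'n \<Rightarrow> 'n \<Rightarrow> (real^'n^'n \<Rightarrow> real) \<Rightarrow> real^'n^'n \<Rightarrow> real" where
  "entry_deriv i j f M = deriv (\<lambda>t. f (M + t *\<^sub>R axis i (axis j 1))) 0"

definition hessian :: "(real^'n^'n \<Rightarrow> real) \<Rightarrow> real^'n^'n \<Rightarrow> real^'n^'n \<Rightarrow> real^'n^'n \<Rightarrow> real" where
  "hessian f M K L =
     (\<Sum>i\<in>UNIV. \<Sum>j\<in>UNIV. \<Sum>k\<in>UNIV. \<Sum>l\<in>UNIV.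
        entry_deriv i j (entry_deriv k l f) M * K $ i $ j * L $ k $ l)"

definition restricted_isometry :: "real \<Rightarrow> nat \<Rightarrow> (real^'n^'n \<Rightarrow> real) \<Rightarrow> bool" where
  "restricted_isometry \<delta> s f \<longleftrightarrow>
     (\<forall>M K. rank M \<le> s \<longrightarrow> rank K \<le> s \<longrightarrow>
        (1 - \<delta>) * (norm K)\<^sup>2 \<le> hessian f M K K \<and>
        hessian f M K K \<le> (1 + \<delta>) * (norm K)\<^sup>2)"

definition global_minimizer :: "('a \<Rightarrow> real) \<Rightarrow> 'a \<Rightarrow> bool" where
  "global_minimizer g x \<longleftrightarrow> (\<forall>y. g x \<le> g y)"

definition local_minimizer :: "('a::topological_space \<Rightarrow> real) \<Rightarrow> 'a \<Rightarrow> bool" where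
  "local_minimizer g x \<longleftrightarrow> (\<forall>\<^sub>F y in nhds x. g x \<le> g y)"

definition spurious_local_minimizer :: "('a::topological_space \<Rightarrow> real) \<Rightarrow> 'a \<Rightarrow> bool" where
  "spurious_local_minimizer g x \<longleftrightarrow> local_minimizer g x \<and> \<not> global_minimizer g x"

end

theory Submission
  imports Defs
begin

text \<open>
  Write \<open>E = X X\<^sup>T - M*\<close> for a local minimizer \<open>X\<close> that is close to \<open>M*\<close>. If \<open>\<lambda>\<^sub>r(M*) \<le> 0\<close> the
  closeness assumption already gives \<open>E = 0\<close>, and then \<open>X\<close> is a global minimizer because \<open>M*\<close> is one
  of \<open>f\<close>. So suppose \<open>\<lambda> = \<lambda>\<^sub>r(M*) > 0\<close> and, for a contradiction, \<open>E \<noteq> 0\<close>.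

  Let \<open>P\<close> be the orthogonal projection onto the column space of \<open>X\<close> and \<open>P' = 1 - P\<close>. Stationarity
  of \<open>Y \<mapsto> f (Y Y\<^sup>T)\<close> at \<open>X\<close> says that the gradient of \<open>f\<close> at \<open>X X\<^sup>T\<close> annihilates every direction
  \<open>X U\<^sup>T + U X\<^sup>T\<close>. Among those directions is \<open>K = E + C\<close> with \<open>C = P' M* P' = - P' E P'\<close>, the orthogonal
  projection of \<open>E\<close> onto them (\<open>tangential_difference\<close>). The gradient of \<open>f\<close> at \<open>M*\<close> vanishes
  altogether, so Rolle's theorem on the segment from \<open>M*\<close> to \<open>X X\<^sup>T\<close> gives a point \<open>N\<close> on it with
  \<open>[\<nabla>\<^sup>2 f(N)](E, K) = 0\<close>. The matrix \<open>N\<close> and every combination of \<open>E\<close> and \<open>K\<close> have their column space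
  inside that of \<open>X\<close> plus that of \<open>M*\<close>, hence rank at most \<open>2r\<close>; the restricted isometry
  property therefore pinches the Hessian at \<open>N\<close> between \<open>1 - \<delta>\<close> and \<open>1 + \<delta>\<close> times the inner product on
  the plane of \<open>E\<close> and \<open>K\<close>. Two vectors that are orthogonal for such a form enclose an angle whose cosine is at
  most \<open>\<delta>\<close> (\<open>restricted_cosine_bound\<close>).

  On the other hand that cosine is \<open>\<parallel>K\<parallel> / \<parallel>E\<parallel>\<close>, and \<open>\<parallel>K\<parallel>\<^sup>2 = \<parallel>E\<parallel>\<^sup>2 - \<parallel>C\<parallel>\<^sup>2\<close>. The part \<open>C\<close> is quadratically
  small: factor \<open>M* = Z Z\<^sup>T\<close> with \<open>\<parallel>Z v\<parallel>\<^sup>2 \<ge> \<lambda> \<parallel>v\<parallel>\<^sup>2\<close>, and put \<open>Y = P Z\<close>, \<open>W = P' Z\<close>. Then \<open>C = W W\<^sup>T\<close>, while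
  \<open>E\<close> has the off-diagonal block \<open>- Y W\<^sup>T\<close> twice, so that
  \<open>\<parallel>E\<parallel>\<^sup>2 \<ge> 2 a \<parallel>W\<parallel>\<^sup>2 + \<parallel>C\<parallel>\<^sup>2 \<ge> 2 a \<parallel>C\<parallel>\<close> for the least value \<open>a\<close> of \<open>\<parallel>Y v\<parallel>\<^sup>2\<close> on unit vectors. The same estimate at the
  minimizing \<open>v\<close> gives \<open>a\<^sup>2 \<ge> \<lambda>\<^sup>2 - \<parallel>E\<parallel>\<^sup>2\<close>, which is bounded below by a multiple of \<open>\<lambda>\<^sup>2\<close> since
  \<open>\<parallel>E\<parallel> \<le> \<epsilon> \<lambda>\<close> with \<open>\<epsilon> \<le> 2 (\<surd>2 - 1)\<close>. Together \<open>\<parallel>C\<parallel>\<^sup>2 \<le> (3 + 2 \<surd>2) / 4 \<epsilon>\<^sup>2 \<parallel>E\<parallel>\<^sup>2\<close>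
  (\<open>normal_component_bound\<close>), and the cosine exceeds \<open>\<delta>\<close>: a contradiction.

  Beyond this geometry the proof needs the spectral theorem for real symmetric matrices, in a form
  that identifies the roots of the characteristic polynomial with the diagonal entries, and the
  symmetry of the second derivative.
\<close>

section \<open>Diagonalization of symmetric matrices\<close>

lemma symmetric_inner_matrix_vector:
  fixes A :: "real^'n^'n"
  assumes "transpose A = A"
  shows "x \<bullet> (A *v y) = (A *v x) \<bullet> y"
  by (metis assms dot_lmul_matrix transpose_matrix_vector)

text \<open>
  A maximizer \<open>v\<close> of the Rayleigh quotient on the unit sphere of the subspace is an eigenvector: with
  \<open>m\<close> the maximum, the form \<open>q y = m (y \<bullet> y) - y \<bullet> A y\<close> is nonnegative on the subspace and vanishes at \<open>v\<close>,
  so its first variation at \<open>v\<close> in the direction of the defect \<open>A v - m v\<close> must vanish too.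
\<close>

lemma symmetric_eigenvector_in_invariant_subspace:
  fixes A :: "real^'n^'n"
  assumes sym: "transpose A = A" and S: "subspace S"
    and inv: "\<And>x. x \<in> S \<Longrightarrow> A *v x \<in> S" and nontriv: "\<exists>x\<in>S. x \<noteq> 0"
  obtains v m where "v \<in> S" "norm v = 1" "A *v v = m *\<^sub>R v"
proof -
  let ?U = "sphere 0 1 \<inter> S"
  have "compact ?U"
    using S by (intro compact_Int_closed closed_subspace) auto
  moreover have "?U \<noteq> {}"
  proof -
    obtain x where "x \<in> S" "x \<noteq> 0" using nontriv by blast
    then have "(1 / norm x) *\<^sub>R x \<in> ?U"
      using S by (simp add: subspace_scale)
    then show ?thesis by blast
  qed
  moreover have "continuous_on ?U (\<lambda>x. x \<bullet> (A *v x))"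
    by (intro continuous_intros linear_continuous_on matrix_vector_mul_bounded_linear)
  ultimately obtain v where v: "v \<in> ?U" and max: "\<And>y. y \<in> ?U \<Longrightarrow> y \<bullet> (A *v y) \<le> v \<bullet> (A *v v)"
    using continuous_attains_sup[of ?U "\<lambda>x. x \<bullet> (A *v x)"] by blast
  define m where "m = v \<bullet> (A *v v)"
  define q where "q y = m * (y \<bullet> y) - y \<bullet> (A *v y)" for y
  have vv: "v \<bullet> v = 1" using v by (simp add: dot_square_norm)
  have q_nonneg: "0 \<le> q y" if "y \<in> S" for y
  proof (cases "y = 0")
    case False
    let ?u = "(1 / norm y) *\<^sub>R y"
    have "?u \<in> ?U" using that False S by (simp add: subspace_scale)
    from max[OF this] have "?u \<bullet> (A *v ?u) \<le> m" by (simp add: m_def)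
    then show ?thesis
      using False
      by (simp add: q_def matrix_vector_mult_scaleR dot_square_norm field_simps power2_eq_square)
  qed (simp add: q_def)
  define w where "w = A *v v - m *\<^sub>R v"
  have w: "w \<in> S"
    using v S inv by (auto simp: w_def intro!: subspace_diff subspace_scale)
  have expand: "q (v + t *\<^sub>R w) = t\<^sup>2 * q w - 2 * t * (w \<bullet> w)" for t
  proof -
    have "w \<bullet> (A *v v) = w \<bullet> w + m * (w \<bullet> v)"
      by (simp add: w_def algebra_simps inner_diff_right inner_commute)
    moreover have "v \<bullet> (A *v w) = w \<bullet> (A *v v)"
      using symmetric_inner_matrix_vector[OF sym, of v w] by (simp add: inner_commute)
    ultimately show ?thesis
      by (simp add: q_def matrix_vector_right_distrib matrix_vector_mult_scaleR inner_add_left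
          inner_add_right inner_commute[of v w] vv m_def[symmetric] algebra_simps power2_eq_square)
  qed
  have "w = 0"
  proof (rule ccontr)
    assume "w \<noteq> 0"
    then have pos: "0 < w \<bullet> w" by simp
    \<comment> \<open>The step \<open>t\<close> is small enough for the linear term of \<open>q (v + t w)\<close> to outweigh the quadratic
      one; the summand \<open>w \<bullet> w\<close> in the denominator keeps it positive when \<open>q w = 0\<close>.\<close>
    define t where "t = (w \<bullet> w) / (q w + w \<bullet> w)"
    have qw: "0 \<le> q w" by (rule q_nonneg[OF w])
    have t: "0 < t" unfolding t_def using pos qw by (intro divide_pos_pos add_nonneg_pos)
    have "0 \<le> t * (t * q w - 2 * (w \<bullet> w))"
      using q_nonneg[of "v + t *\<^sub>R w"] v w S
      by (simp add: expand subspace_add subspace_scale algebra_simps power2_eq_square)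
    then have "2 * (w \<bullet> w) \<le> t * q w"
      using t by (simp add: zero_le_mult_iff)
    moreover have "t * q w \<le> w \<bullet> w"
      unfolding t_def times_divide_eq_left using pos qw
      by (subst pos_divide_le_eq) (auto simp: add_nonneg_pos algebra_simps)
    ultimately show False using pos by simp
  qed
  then show ?thesis using that[of v m] v by (simp add: w_def)
qed

text \<open>
  Induction on the dimension: the vectors of \<open>S\<close> orthogonal to one eigenvector again form an
  invariant subspace. Working with invariant subspaces avoids restricting \<open>A\<close> to a smaller matrix.
\<close>

lemma symmetric_invariant_subspace_orthonormal_eigenbasis:
  fixes A :: "real^'n^'n"
  assumes sym: "transpose A = A" and "subspace S" and "\<And>x. x \<in> S \<Longrightarrow> A *v x \<in> S"
  shows "\<exists>B. finite B \<and> pairwise orthogonal B \<and> span B = S \<and>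
           (\<forall>b\<in>B. norm b = 1 \<and> (\<exists>c. A *v b = c *\<^sub>R b))"
  using assms(2,3)
proof (induction "dim S" arbitrary: S rule: less_induct)
  case less
  show ?case
  proof (cases "\<exists>x\<in>S. x \<noteq> 0")
    case False
    then have "S = {0}" using less.prems(1) subspace_0 by blast
    then show ?thesis by (intro exI[of _ "{}"]) simp
  next
    case True
    obtain v m where v: "v \<in> S" "norm v = 1" "A *v v = m *\<^sub>R v"
      using symmetric_eigenvector_in_invariant_subspace[OF sym less.prems True] by blast
    have vv: "v \<bullet> v = 1" using v(2) by (simp add: dot_square_norm)
    define T where "T = {x \<in> S. v \<bullet> x = 0}"
    have T: "subspace T"
      using less.prems(1) by (auto simp: T_def subspace_def inner_add_right)
    have "v \<in> S" "v \<notin> T" "T \<subseteq> S" using v vv by (auto simp: T_def)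
    then have "T \<subset> S" by blast
    then have "dim T < dim S"
      using T less.prems(1) by (metis dim_psubset span_eq_iff)
    moreover have "A *v x \<in> T" if "x \<in> T" for x
      using that less.prems(2) symmetric_inner_matrix_vector[OF sym, of v x] v
      by (simp add: T_def)
    ultimately obtain B where B: "finite B" "pairwise orthogonal B" "span B = T"
      "\<forall>b\<in>B. norm b = 1 \<and> (\<exists>c. A *v b = c *\<^sub>R b)"
      using less.hyps[OF _ T] by blast
    have BT: "B \<subseteq> T" using B(3) span_superset by blast
    have "pairwise orthogonal (insert v B)"
      using B(2) BT by (auto simp: pairwise_insert orthogonal_def T_def inner_commute)
    moreover have "span (insert v B) = S"
    proof
      show "span (insert v B) \<subseteq> S"
        using v BT less.prems(1) by (intro span_minimal) (auto simp: T_def)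
      show "S \<subseteq> span (insert v B)"
      proof
        fix x assume "x \<in> S"
        then have "x - (v \<bullet> x) *\<^sub>R v \<in> T"
          using v vv less.prems(1)
          by (simp add: T_def subspace_diff subspace_scale inner_diff_right)
        then show "x \<in> span (insert v B)"
          using B(3) by (auto simp: span_insert)
      qed
    qed
    ultimately show ?thesis
      using B v by (intro exI[of _ "insert v B"]) auto
  qed
qed

lemma symmetric_orthogonal_diagonalization:
  fixes A :: "real^'n^'n"
  assumes sym: "transpose A = A"
  obtains Q :: "real^'n^'n" and d :: "'n \<Rightarrow> real"
  where "orthogonal_matrix Q" "A ** Q = Q ** (\<chi> i j. if i = j then d i else 0)"
proof -
  obtain B where B: "finite B" "pairwise orthogonal B" "span B = (UNIV :: (real^'n) set)"
      "\<forall>b\<in>B. norm b = 1 \<and> (\<exists>c. A *v b = c *\<^sub>R b)"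
    using symmetric_invariant_subspace_orthonormal_eigenbasis[OF sym subspace_UNIV] by auto
  have "independent B"
    using B by (intro pairwise_orthogonal_independent) auto
  then have "card B = CARD('n)"
    using B(3) dim_eq_card[of B UNIV] by simp
  then obtain q where q: "bij_betw q (UNIV :: 'n set) B"
    using B(1) finite_same_card_bij[of "UNIV :: 'n set" B] by auto
  obtain c where c: "\<And>b. b \<in> B \<Longrightarrow> A *v b = c b *\<^sub>R b" using B(4) by metis
  define Q :: "real^'n^'n" where "Q = (\<chi> i j. q j $ i)"
  have col: "column j Q = q j" for j by (simp add: column_def Q_def vec_eq_iff)
  have qB: "q j \<in> B" for j using q by (auto simp: bij_betw_def)
  have "orthogonal_matrix Q"
    unfolding orthogonal_matrix_orthonormal_columns col
  proof (intro conjI allI impI)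
    show "norm (q i) = 1" for i using B(4) qB by blast
    show "orthogonal (q i) (q j)" if "i \<noteq> j" for i j
      using pairwiseD[OF B(2) qB qB, of i j] that q by (simp add: bij_betw_def inj_eq)
  qed
  moreover have "A ** Q = Q ** (\<chi> i j. if i = j then c (q i) else 0)"
  proof -
    have "(A ** Q) $ i $ j = q j $ i * c (q j)" for i j
    proof -
      have "(A ** Q) $ i $ j = (A *v q j) $ i"
        by (simp add: matrix_matrix_mult_def matrix_vector_mult_def Q_def)
      then show ?thesis using c[OF qB] by simp
    qed
    then show ?thesis
      by (simp add: vec_eq_iff) (simp add: matrix_matrix_mult_def Q_def if_distrib cong: if_cong)
  qed
  ultimately show ?thesis using that[of Q "\<lambda>i. c (q i)"] by blast
qed

lemma map_matrix_const_poly_mult: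
  fixes A :: "'a::comm_ring_1^'n^'m" and B :: "'a^'p^'n"
  shows "map_matrix (\<lambda>a. [:a:]) (A ** B) = map_matrix (\<lambda>a. [:a:]) A ** map_matrix (\<lambda>a. [:a:]) B"
proof -
  have "[:\<Sum>k\<in>UNIV. A $ i $ k * B $ k $ j:] = (\<Sum>k\<in>UNIV. [:A $ i $ k:] * [:B $ k $ j:])" for i j
    by (simp add: sum_to_poly mult.commute)
  then show ?thesis by (simp add: vec_eq_iff matrix_matrix_mult_def)
qed

text \<open>
  Conjugation by the constant polynomial matrix of \<open>Q\<close> turns \<open>x - A\<close> into a diagonal matrix, whose
  determinant is a product of linear factors.
\<close>

lemma mset_proots_charpoly_diagonalized:
  fixes A Q :: "real^'n^'n" and d :: "'n \<Rightarrow> real"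
  assumes Q: "orthogonal_matrix Q" and AQ: "A ** Q = Q ** (\<chi> i j. if i = j then d i else 0)"
  shows "proots (charpoly A) = image_mset d (mset_set UNIV)"
proof -
  let ?c = "map_matrix (\<lambda>a::real. [:a:])"
  let ?D = "(\<chi> i j. if i = j then d i else 0) :: real^'n^'n"
  let ?X = "mat [:0, 1:] :: real poly^'n^'n"
  have X_comm: "?X ** M = M ** ?X" for M :: "real poly^'n^'n"
    by (simp add: vec_eq_iff matrix_matrix_mult_def mat_def if_distrib if_distribR mult.commute cong: if_cong)
  have diff_l: "(M - N) ** P = M ** P - N ** P" and diff_r: "P ** (M - N) = P ** M - P ** N"
    for M N P :: "real poly^'n^'n"
    by (simp_all add: vec_eq_iff matrix_matrix_mult_def algebra_simps sum_subtractf)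
  have one: "?c (mat 1) = mat 1" by (simp add: vec_eq_iff mat_def)
  have "det (?c (transpose Q)) * det (?c Q) = 1"
    using Q by (simp add: det_mul[symmetric] map_matrix_const_poly_mult[symmetric] orthogonal_matrix one)
  then have nz: "det (?c Q) \<noteq> 0" by auto
  have "(?X - ?c A) ** ?c Q = ?c Q ** (?X - ?c ?D)"
    by (simp add: diff_l diff_r X_comm map_matrix_const_poly_mult[symmetric] AQ)
  then have "charpoly A * det (?c Q) = det (?c Q) * det (?X - ?c ?D)"
    unfolding charpoly_def by (simp flip: det_mul)
  then have "charpoly A = det (?X - ?c ?D)" using nz by simp
  also have "\<dots> = (\<Prod>i\<in>UNIV. [:- d i, 1:])"
    by (subst det_diagonal) (auto simp: mat_def)
  finally have "charpoly A = (\<Prod>i\<in>UNIV. [:- d i, 1:])" .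
  moreover have "(\<Sum>i\<in>I. {#d i#}) = image_mset d (mset_set I)" if "finite I" for I
    using that by (induction I) auto
  ultimately show ?thesis by (simp add: proots_prod)
qed

lemma card_eigenvalues_ge_eigenvalue_desc:
  fixes A :: "real^'n^'n" and d :: "'n \<Rightarrow> real"
  assumes roots: "proots (charpoly A) = image_mset d (mset_set UNIV)"
    and k: "1 \<le> k" "k \<le> CARD('n)"
  shows "k \<le> card {i. eigenvalue_desc A k \<le> d i}"
proof -
  define L where "L = rev (sorted_list_of_multiset (proots (charpoly A)))"
  let ?l = "eigenvalue_desc A k"
  have mset_L: "mset L = image_mset d (mset_set UNIV)"
    by (simp add: L_def roots)
  then have len: "length L = CARD('n)" by (metis size_image_mset size_mset size_mset_set)
  have "?l \<le> L ! j" if "j < k" for j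
  proof -
    have "L ! (k - 1) \<le> L ! j"
      using sorted_rev_nth_mono[of L j "k - 1"] that k len by (simp add: L_def)
    then show ?thesis by (simp add: eigenvalue_desc_def L_def)
  qed
  then have "\<forall>x \<in> set (take k L). ?l \<le> x"
    using len k by (auto simp: in_set_conv_nth)
  then have "k = length (filter (\<lambda>x. ?l \<le> x) (take k L))"
    using len k by simp
  also have "\<dots> \<le> length (filter (\<lambda>x. ?l \<le> x) L)"
    by (metis append_take_drop_id filter_append le_add1 length_append)
  also have "\<dots> = size (filter_mset (\<lambda>x. ?l \<le> x) (mset L))"
    by (metis mset_filter size_mset)
  also have "\<dots> = card {i. ?l \<le> d i}"
    by (simp add: mset_L filter_mset_image_mset)
  finally show ?thesis .
qed

text \<open>
  At least \<open>r\<close> eigenvalues, counted with multiplicity, are \<open>\<ge> \<lambda>\<^sub>r > 0\<close>, and by the rank bound at most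
  \<open>r\<close> are nonzero. Hence the nonzero eigenvalues are exactly \<open>r\<close> many and all \<open>\<ge> \<lambda>\<^sub>r\<close>, so that they and
  their eigenvectors can be indexed by the type \<^typ>\<open>'r\<close>; scaling each eigenvector by the root of its
  eigenvalue gives the columns of \<open>Z\<close>.
\<close>

lemma symmetric_low_rank_factorization:
  fixes A :: "real^'n^'n"
  assumes sym: "transpose A = A" and rank: "rank A \<le> CARD('r::finite)"
    and card: "CARD('r) \<le> CARD('n)" and pos: "0 < eigenvalue_desc A (CARD('r))"
  obtains Z :: "real^'r^'n" where "A = Z ** transpose Z"
    "\<And>v. eigenvalue_desc A (CARD('r)) * (norm v)\<^sup>2 \<le> (norm (Z *v v))\<^sup>2"
proof -
  let ?l = "eigenvalue_desc A (CARD('r))"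
  obtain Q d where Q: "orthogonal_matrix Q" and AQ: "A ** Q = Q ** (\<chi> i j. if i = j then d i else 0)"
    using symmetric_orthogonal_diagonalization[OF sym] .
  let ?I = "{i. d i \<noteq> 0}"
  have AQcol: "A *v column i Q = d i *\<^sub>R column i Q" for i
  proof -
    have "(A ** Q) $ k $ i = (A *v column i Q) $ k" for k
      by (simp add: matrix_matrix_mult_def matrix_vector_mult_def column_def)
    moreover have "(A ** Q) $ k $ i = d i * Q $ k $ i" for k
      unfolding AQ by (simp add: matrix_matrix_mult_def if_distrib cong: if_cong)
    ultimately show ?thesis by (simp add: vec_eq_iff column_def)
  qed
  have orth: "column i Q \<bullet> column j Q = (if i = j then 1 else 0)" for i j
    using Q by (auto simp: orthogonal_matrix_orthonormal_columns orthogonal_def dot_square_norm)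
  have "card ?I \<le> rank A"
  proof -
    let ?C = "(\<lambda>i. column i Q) ` ?I"
    have inj: "inj_on (\<lambda>i. column i Q) ?I"
    proof (rule inj_onI)
      fix i j assume "column i Q = column j Q"
      then have "column i Q \<bullet> column j Q = 1" using orth[of j j] by simp
      then show "i = j" by (simp add: orth split: if_splits)
    qed
    have nonzero: "column i Q \<noteq> 0" for i using orth[of i i] by auto
    have "independent ?C"
    proof (rule pairwise_orthogonal_independent)
      show "pairwise orthogonal ?C" using orth by (fastforce simp: pairwise_def orthogonal_def)
      show "0 \<notin> ?C" using nonzero by (auto simp: image_iff eq_commute[of 0])
    qed
    moreover have "?C \<subseteq> range ((*v) A)"
    proof
      fix x assume "x \<in> ?C"
      then obtain i where "d i \<noteq> 0" "x = column i Q" by auto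
      then have "A *v ((1 / d i) *\<^sub>R x) = x" by (simp add: matrix_vector_mult_scaleR AQcol)
      then show "x \<in> range ((*v) A)" by (metis rangeI)
    qed
    ultimately have "card ?C \<le> dim (range ((*v) A))"
      by (intro independent_card_le_dim)
    then show ?thesis by (simp add: rank_dim_range card_image[OF inj])
  qed
  moreover have ge: "CARD('r) \<le> card {i. ?l \<le> d i}"
    using mset_proots_charpoly_diagonalized[OF Q AQ] card
    by (intro card_eigenvalues_ge_eigenvalue_desc) (auto simp: Suc_le_eq)
  moreover have "{i. ?l \<le> d i} \<subseteq> ?I" using pos by auto
  ultimately have eq: "{i. ?l \<le> d i} = ?I" and "card ?I = CARD('r)"
    using rank card_mono[of ?I "{i. ?l \<le> d i}"] card_subset_eq[of ?I "{i. ?l \<le> d i}"] by auto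
  then obtain p where p: "bij_betw p (UNIV :: 'r set) ?I"
    using finite_same_card_bij[of "UNIV :: 'r set" ?I] by auto
  have dp: "?l \<le> d (p k)" for k using p eq by (auto simp: bij_betw_def)
  define Z :: "real^'r^'n" where "Z = (\<chi> i k. sqrt (d (p k)) * Q $ i $ p k)"
  have "Q ** transpose Q = mat 1" using Q by (simp add: orthogonal_matrix_def)
  then have "A = (A ** Q) ** transpose Q" by (simp add: matrix_mul_assoc[symmetric])
  also have "\<dots> = Z ** transpose Z"
  proof -
    have "(\<Sum>k\<in>UNIV. Q $ i $ k * d k * Q $ j $ k) = (\<Sum>k\<in>UNIV. Z $ i $ k * Z $ j $ k)" for i j
    proof -
      have "(\<Sum>k\<in>UNIV. Q $ i $ k * d k * Q $ j $ k) = (\<Sum>k\<in>?I. Q $ i $ k * d k * Q $ j $ k)"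
        by (rule sum.mono_neutral_right) auto
      also have "\<dots> = (\<Sum>k\<in>UNIV. Q $ i $ p k * d (p k) * Q $ j $ p k)"
        by (rule sum.reindex_bij_betw[OF p, symmetric])
      also have "\<dots> = (\<Sum>k\<in>UNIV. Z $ i $ k * Z $ j $ k)"
      proof (rule sum.cong[OF refl])
        fix k
        have "sqrt (d (p k)) * sqrt (d (p k)) = d (p k)" using dp[of k] pos by simp
        then show "Q $ i $ p k * d (p k) * Q $ j $ p k = Z $ i $ k * Z $ j $ k"
          by (simp add: Z_def algebra_simps)
      qed
      finally show ?thesis .
    qed
    then show ?thesis unfolding AQ
      by (simp add: vec_eq_iff matrix_matrix_mult_def transpose_def if_distrib cong: if_cong)
  qed
  finally have "A = Z ** transpose Z" .
  moreover have "?l * (norm v)\<^sup>2 \<le> (norm (Z *v v))\<^sup>2" for v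
  proof -
    have "Z *v v = (\<Sum>k\<in>UNIV. (sqrt (d (p k)) * v $ k) *\<^sub>R column (p k) Q)"
      by (simp add: vec_eq_iff matrix_vector_mult_def Z_def column_def algebra_simps)
    then have "(norm (Z *v v))\<^sup>2 =
        (\<Sum>j\<in>UNIV. \<Sum>k\<in>UNIV. (sqrt (d (p k)) * v $ k) * ((sqrt (d (p j)) * v $ j) * (column (p k) Q \<bullet> column (p j) Q)))"
      by (simp add: dot_square_norm[symmetric] inner_sum_left inner_sum_right sum_distrib_left mult_ac)
    also have "\<dots> = (\<Sum>j\<in>UNIV. \<Sum>k\<in>UNIV. if k = j then d (p j) * (v $ j)\<^sup>2 else 0)"
    proof (intro sum.cong refl)
      fix j k :: 'r
      have "p k = p j \<longleftrightarrow> k = j" using p by (auto simp: bij_betw_def inj_on_def)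
      moreover have "sqrt (d (p j)) * sqrt (d (p j)) = d (p j)" using dp[of j] pos by simp
      ultimately show "sqrt (d (p k)) * v $ k * (sqrt (d (p j)) * v $ j * (column (p k) Q \<bullet> column (p j) Q))
          = (if k = j then d (p j) * (v $ j)\<^sup>2 else 0)"
        by (simp add: orth power2_eq_square algebra_simps)
    qed
    also have "\<dots> = (\<Sum>j\<in>UNIV. d (p j) * (v $ j)\<^sup>2)" by simp
    also have "\<dots> \<ge> (\<Sum>j\<in>UNIV. ?l * (v $ j)\<^sup>2)"
      by (intro sum_mono mult_right_mono dp) auto
    also have "(\<Sum>j\<in>UNIV. ?l * (v $ j)\<^sup>2) = ?l * (norm v)\<^sup>2"
      by (simp add: sum_distrib_left[symmetric] power2_norm_eq_inner inner_vec_def)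
        (simp add: power2_eq_square)
    finally show ?thesis .
  qed
  ultimately show ?thesis using that by blast
qed

section \<open>Frobenius inner product and matrix products\<close>

lemma inner_matrix_mult_left:
  fixes A :: "real^'n^'m" and B :: "real^'p^'n"
  shows "(A ** B) \<bullet> C = B \<bullet> (transpose A ** C)"
proof -
  have "(A ** B) \<bullet> C = (\<Sum>i\<in>UNIV. \<Sum>j\<in>UNIV. \<Sum>k\<in>UNIV. A $ i $ k * B $ k $ j * C $ i $ j)"
    by (simp add: inner_vec_def matrix_matrix_mult_def sum_distrib_right)
  also have "\<dots> = (\<Sum>i\<in>UNIV. \<Sum>k\<in>UNIV. \<Sum>j\<in>UNIV. A $ i $ k * B $ k $ j * C $ i $ j)"
    by (intro sum.cong refl sum.swap)
  also have "\<dots> = (\<Sum>k\<in>UNIV. \<Sum>i\<in>UNIV. \<Sum>j\<in>UNIV. A $ i $ k * B $ k $ j * C $ i $ j)"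
    by (rule sum.swap)
  also have "\<dots> = (\<Sum>k\<in>UNIV. \<Sum>j\<in>UNIV. \<Sum>i\<in>UNIV. A $ i $ k * B $ k $ j * C $ i $ j)"
    by (intro sum.cong refl sum.swap)
  also have "\<dots> = B \<bullet> (transpose A ** C)"
    by (simp add: inner_vec_def matrix_matrix_mult_def transpose_def sum_distrib_left mult_ac)
  finally show ?thesis .
qed

lemma inner_transpose_matrix:
  fixes A :: "real^'n^'m"
  shows "transpose A \<bullet> transpose B = A \<bullet> B"
  by (simp add: inner_vec_def transpose_def) (rule sum.swap)

lemma inner_matrix_mult_right:
  fixes A :: "real^'n^'m" and B :: "real^'p^'n"
  shows "(A ** B) \<bullet> C = A \<bullet> (C ** transpose B)"
  using inner_matrix_mult_left[of "transpose B" "transpose A" "transpose C"]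
    inner_transpose_matrix[of "A ** B" C] inner_transpose_matrix[of A "C ** transpose B"]
  by (simp add: matrix_transpose_mul)

lemma norm_transpose_matrix:
  fixes A :: "real^'n^'m"
  shows "norm (transpose A) = norm A"
  by (simp add: norm_eq_sqrt_inner inner_transpose_matrix)

lemma norm_matrix_sq_columns:
  fixes A :: "real^'n^'m"
  shows "(norm A)\<^sup>2 = (\<Sum>j\<in>UNIV. (norm (column j A))\<^sup>2)"
proof -
  have "(norm A)\<^sup>2 = (norm (transpose A))\<^sup>2" by (simp add: norm_transpose_matrix)
  also have "\<dots> = (\<Sum>j\<in>UNIV. (norm (column j A))\<^sup>2)"
    by (simp add: power2_norm_eq_inner inner_vec_def transpose_def column_def)
  finally show ?thesis .
qed

lemma column_matrix_mult:
  fixes A :: "real^'n^'m" and B :: "real^'p^'n"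
  shows "column j (A ** B) = A *v column j B"
  by (simp add: vec_eq_iff column_def matrix_matrix_mult_def matrix_vector_mult_def)

lemma norm_matrix_vector_mult_le:
  fixes A :: "real^'n^'m"
  shows "norm (A *v x) \<le> norm A * norm x"
proof (rule power2_le_imp_le)
  have "(norm (A *v x))\<^sup>2 = (\<Sum>i\<in>UNIV. (A $ i \<bullet> x)\<^sup>2)"
    unfolding power2_norm_eq_inner by (simp add: matrix_mult_dot inner_vec_def[of "vec_lambda _"] power2_eq_square)
  also have "\<dots> \<le> (\<Sum>i\<in>UNIV. (norm (A $ i))\<^sup>2 * (norm x)\<^sup>2)"
    by (intro sum_mono) (metis Cauchy_Schwarz_ineq2 abs_ge_zero power2_abs power_mono power_mult_distrib)
  also have "\<dots> = (norm A * norm x)\<^sup>2"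
    by (simp add: power_mult_distrib power2_norm_eq_inner inner_vec_def[of A] sum_distrib_right)
  finally show "(norm (A *v x))\<^sup>2 \<le> (norm A * norm x)\<^sup>2" .
qed simp

lemma norm_matrix_mult_le:
  fixes A :: "real^'n^'m" and B :: "real^'p^'n"
  shows "norm (A ** B) \<le> norm A * norm B"
proof (rule power2_le_imp_le)
  have "(norm (A ** B))\<^sup>2 = (\<Sum>j\<in>UNIV. (norm (A *v column j B))\<^sup>2)"
    by (simp add: norm_matrix_sq_columns[of "A ** B"] column_matrix_mult)
  also have "\<dots> \<le> (\<Sum>j\<in>UNIV. (norm A)\<^sup>2 * (norm (column j B))\<^sup>2)"
    by (intro sum_mono) (metis norm_ge_zero norm_matrix_vector_mult_le power_mono power_mult_distrib)
  also have "\<dots> = (norm A * norm B)\<^sup>2"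
    by (simp add: power_mult_distrib norm_matrix_sq_columns[of B] sum_distrib_left)
  finally show "(norm (A ** B))\<^sup>2 \<le> (norm A * norm B)\<^sup>2" .
qed simp

interpretation matrix_mult: bounded_bilinear "(**) :: real^'n^'m \<Rightarrow> real^'p^'n \<Rightarrow> real^'p^'m"
proof
  show "\<exists>K. \<forall>(a::real^'n^'m) (b::real^'p^'n). norm (a ** b) \<le> norm a * norm b * K"
    by (intro exI[of _ 1]) (simp add: norm_matrix_mult_le)
qed (simp_all add: vec_eq_iff matrix_matrix_mult_def algebra_simps sum.distrib sum_distrib_left)

lemma linear_transpose_matrix: "linear (transpose :: real^'n^'m \<Rightarrow> real^'m^'n)"
  by (rule linearI) (simp_all add: vec_eq_iff transpose_def)

lemmas transpose_matrix_diff = linear_diff[OF linear_transpose_matrix]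
lemmas transpose_matrix_minus = linear_neg[OF linear_transpose_matrix]
lemmas transpose_matrix_zero = linear_0[OF linear_transpose_matrix]

lemma norm_matrix_mult_ge:
  fixes Y :: "real^'n^'m" and B :: "real^'p^'n"
  assumes "\<And>w. a * (norm w)\<^sup>2 \<le> (norm (Y *v w))\<^sup>2"
  shows "a * (norm B)\<^sup>2 \<le> (norm (Y ** B))\<^sup>2"
  using assms
  by (simp add: norm_matrix_sq_columns[of B] norm_matrix_sq_columns[of "Y ** B"] column_matrix_mult
      sum_distrib_left sum_mono)

lemma norm_gram_matrix:
  fixes W :: "real^'n^'m"
  shows "norm (transpose W ** W) = norm (W ** transpose W)"
proof -
  have "(W ** transpose W) \<bullet> (W ** transpose W) = (transpose W ** W) \<bullet> (transpose W ** W)"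
    by (simp add: inner_matrix_mult_left[of W] inner_matrix_mult_right[of "transpose W" W] matrix_mul_assoc)
  then show ?thesis by (simp add: norm_eq_sqrt_inner)
qed

text \<open>
  The left side is the quadratic form of \<open>W\<^sup>T W\<close> at \<open>v\<close>, and \<open>W\<^sup>T W\<close> has the same Frobenius norm as
  \<open>W W\<^sup>T\<close>.
\<close>

lemma norm_sq_matrix_vector_le:
  fixes W :: "real^'n^'m"
  shows "(norm (W *v v))\<^sup>2 \<le> norm (W ** transpose W) * (norm v)\<^sup>2"
proof -
  have "(norm (W *v v))\<^sup>2 = v \<bullet> ((transpose W ** W) *v v)"
    by (simp add: power2_norm_eq_inner dot_lmul_matrix flip: matrix_vector_mul_assoc transpose_matrix_vector)
       (metis dot_lmul_matrix transpose_matrix_vector transpose_transpose)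
  also have "\<dots> \<le> norm v * norm ((transpose W ** W) *v v)"
    by (rule norm_cauchy_schwarz)
  also have "\<dots> \<le> norm v * (norm (transpose W ** W) * norm v)"
    by (intro mult_left_mono norm_matrix_vector_mult_le) simp
  finally show ?thesis by (simp add: norm_gram_matrix power2_eq_square mult_ac)
qed

lemma minimal_stretch_attained:
  fixes Y :: "real^'n^'m"
  obtains v where "norm v = 1" "\<And>w. (norm (Y *v v))\<^sup>2 * (norm w)\<^sup>2 \<le> (norm (Y *v w))\<^sup>2"
proof -
  have "continuous_on (sphere 0 1) (\<lambda>w. norm (Y *v w))"
    by (intro continuous_intros linear_continuous_on matrix_vector_mul_bounded_linear)
  then obtain v :: "real^'n" where v: "v \<in> sphere 0 1"
      and min: "\<And>w. w \<in> sphere 0 1 \<Longrightarrow> norm (Y *v v) \<le> norm (Y *v w)"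
    using continuous_attains_inf[of "sphere 0 1 :: (real^'n) set" "\<lambda>w. norm (Y *v w)"]
    by fastforce
  have "norm (Y *v v) * norm w \<le> norm (Y *v w)" for w
  proof (cases "w = 0")
    case False
    then have "norm (Y *v v) \<le> norm (Y *v ((1 / norm w) *\<^sub>R w))" by (intro min) simp
    then show ?thesis using False by (simp add: matrix_vector_mult_scaleR field_simps)
  qed simp
  then have "(norm (Y *v v))\<^sup>2 * (norm w)\<^sup>2 \<le> (norm (Y *v w))\<^sup>2" for w
    by (metis mult_nonneg_nonneg norm_ge_zero power_mono power_mult_distrib)
  then show ?thesis using that[of v] v by simp
qed

section \<open>The component normal to the column space\<close>

text \<open>
  The columns of \<open>L\<close> are least squares solutions for the unit vectors, so that \<open>X\<^sup>T (1 - X L) = 0\<close>. The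
  normal equations alone give that \<open>X L\<close> is symmetric and idempotent. Having the projection in
  the form \<open>X L\<close> also shows directly that products with it are of the form \<open>X V\<close>, whatever the rank of
  \<open>X\<close> is.
\<close>

lemma column_space_projection:
  fixes X :: "real^'r^'n"
  obtains L :: "real^'n^'r"
  where "transpose (X ** L) = X ** L" "(X ** L) ** (X ** L) = X ** L" "(X ** L) ** X = X"
proof -
  have "\<exists>u. transpose X *v (y - X *v u) = 0" for y
  proof -
    obtain p z where p: "p \<in> span (range ((*v) X))"
        and z: "\<And>w. w \<in> span (range ((*v) X)) \<Longrightarrow> orthogonal z w" and y: "y = p + z"
      using orthogonal_subspace_decomp_exists[of "range ((*v) X)" y] by blast
    have "subspace (range ((*v) X))"
      using linear_subspace_image[OF matrix_vector_mul_linear subspace_UNIV] .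
    then obtain u where u: "p = X *v u" using p by (metis imageE span_eq_iff)
    have "w \<bullet> (transpose X *v z) = 0" for w
      using z[of "X *v w"] dot_lmul_matrix[of z X w]
      by (auto simp: orthogonal_def span_base inner_commute)
    then have "transpose X *v z = 0" by (metis inner_eq_zero_iff)
    then show ?thesis using y u by (intro exI[of _ u]) simp
  qed
  then obtain u where u: "\<And>y. transpose X *v (y - X *v u y) = 0" by metis
  define L :: "real^'n^'r" where "L = (\<chi> i j. u (axis j 1) $ i)"
  let ?P = "X ** L"
  have "column j (transpose X ** (mat 1 - ?P)) = 0" for j
  proof -
    have "column j L = u (axis j 1)" by (simp add: column_def L_def vec_eq_iff)
    then have "column j (mat 1 - ?P) = axis j 1 - X *v u (axis j 1)"
      using column_matrix_mult[of j X L]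
      by (simp add: column_def mat_def axis_def vec_eq_iff)
    then show ?thesis by (simp add: column_matrix_mult u del: transpose_matrix_vector)
  qed
  then have "transpose X ** (mat 1 - ?P) = 0"
    by (simp add: vec_eq_iff column_def)
  then have XP: "transpose X ** ?P = transpose X" by (simp add: matrix_mult.diff_right)
  have TP: "transpose ?P ** ?P = transpose ?P"
    by (simp add: matrix_transpose_mul XP flip: matrix_mul_assoc)
  then have sym: "transpose ?P = ?P"
    by (metis matrix_transpose_mul transpose_transpose)
  moreover have "?P ** ?P = ?P" using TP by (simp add: sym)
  moreover have "?P ** X = X"
    by (metis XP sym matrix_transpose_mul transpose_transpose)
  ultimately show ?thesis using that by blast
qed

lemma pythagoras_projection:
  fixes P :: "real^'n^'n" and A :: "real^'m^'n"
  assumes "transpose P = P" "P ** P = P"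
  shows "(norm A)\<^sup>2 = (norm (P ** A))\<^sup>2 + (norm ((mat 1 - P) ** A))\<^sup>2"
proof -
  have "(P ** A) \<bullet> (A - P ** A) = 0"
    by (simp add: inner_matrix_mult_left[of P] assms matrix_mult.diff_right matrix_mul_assoc)
  then show ?thesis
    by (simp add: matrix_mult.diff_left power2_norm_eq_inner inner_diff inner_commute)
qed

lemma pythagoras_projection_vector:
  fixes P :: "real^'n^'n"
  assumes "transpose P = P" "P ** P = P"
  shows "(norm x)\<^sup>2 = (norm (P *v x))\<^sup>2 + (norm ((mat 1 - P) *v x))\<^sup>2"
proof -
  have "(P *v x) \<bullet> (x - P *v x) = 0"
    using dot_lmul_matrix[of x P "x - P *v x"] assms
    by (metis diff_self inner_zero_right matrix_vector_mul_assoc matrix_vector_mult_diff_distrib transpose_matrix_vector)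
  then show ?thesis
    by (simp add: matrix_vector_mult_diff_rdistrib power2_norm_eq_inner inner_diff inner_commute)
qed

text \<open>
  The scalar part of the bound on the normal component. In the application \<open>l = \<lambda>\<^sub>r(M*)\<close>,
  \<open>F = \<parallel>E\<parallel>\<^sup>2\<close>, \<open>N = \<parallel>W W\<^sup>T\<parallel>\<close>, \<open>T = \<parallel>W\<parallel>\<^sup>2\<close>, and \<open>a\<close>, \<open>c\<close> are the squared lengths of \<open>Y v\<close>, \<open>W v\<close> for the
  unit vector \<open>v\<close> that \<open>Y\<close> stretches least. Everything rests on \<open>l\<^sup>2 - F \<le> a\<^sup>2\<close>: if \<open>a \<le> l\<close> then
  \<open>F \<ge> 2 a (l - a) + (l - a)\<^sup>2 = l\<^sup>2 - a\<^sup>2\<close>.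
\<close>

lemma normal_component_numeric:
  fixes a c T N F l :: real
  assumes nonneg: "0 \<le> a" "0 \<le> c" "0 \<le> T" and l: "0 < l" "l \<le> a + c"
    and N: "c \<le> N" "N \<le> T" and F: "2 * a * T + N\<^sup>2 \<le> F" "F \<le> \<epsilon>\<^sup>2 * l\<^sup>2"
    and eps: "\<epsilon>\<^sup>2 \<le> 4 * (3 - 2 * sqrt 2)"
  shows "N\<^sup>2 \<le> (3 + 2 * sqrt 2) / 4 * \<epsilon>\<^sup>2 * F"
proof -
  have s: "sqrt 2 * sqrt 2 = (2::real)" "1 < sqrt 2" by auto
  have F0: "0 \<le> F" using F(1) nonneg by (smt (verit) mult_nonneg_nonneg zero_le_power2)
  have a2: "l\<^sup>2 - F \<le> a\<^sup>2"
  proof (cases "a \<le> l")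
    case True
    have "a * (l - a) \<le> a * T" using l N nonneg by (intro mult_left_mono) auto
    moreover have "(l - a)\<^sup>2 \<le> N\<^sup>2" using l N True by (intro power_mono) auto
    ultimately show ?thesis using F(1) by (simp add: power2_eq_square algebra_simps)
  next
    case False
    then have "l\<^sup>2 \<le> a\<^sup>2" using l by (intro power_mono) auto
    then show ?thesis using F0 by simp
  qed
  \<comment> \<open>The bound on \<open>\<epsilon>\<close> enters here, leaving \<open>a\<^sup>2 \<ge> (8 \<surd>2 - 11) l\<^sup>2\<close>. This is more than the
    \<open>l\<^sup>2 / (3 + 2 \<surd>2)\<close> that the claim requires, as \<open>(3 + 2 \<surd>2) (8 \<surd>2 - 11) = 2 \<surd>2 - 1 > 1\<close>.\<close>
  have "F \<le> 4 * (3 - 2 * sqrt 2) * l\<^sup>2"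
    using F(2) mult_right_mono[OF eps, of "l\<^sup>2"] by simp
  then have "(8 * sqrt 2 - 11) * l\<^sup>2 \<le> a\<^sup>2" using a2 by (simp add: algebra_simps)
  then have "(3 + 2 * sqrt 2) * ((8 * sqrt 2 - 11) * l\<^sup>2) \<le> (3 + 2 * sqrt 2) * a\<^sup>2"
    by (intro mult_left_mono) auto
  moreover have "(3 + 2 * sqrt 2) * ((8 * sqrt 2 - 11) * l\<^sup>2) = (2 * sqrt 2 - 1) * l\<^sup>2"
    using s(1) by (simp add: algebra_simps)
  moreover have "1 * l\<^sup>2 \<le> (2 * sqrt 2 - 1) * l\<^sup>2"
    using s by (intro mult_right_mono) auto
  ultimately have la: "l\<^sup>2 \<le> (3 + 2 * sqrt 2) * a\<^sup>2" by simp
  then have a: "0 < a\<^sup>2" using l(1) nonneg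
    by (cases "a = 0") auto
  have "2 * a * N \<le> F"
  proof -
    have "2 * a * N \<le> 2 * a * T" using N nonneg by (intro mult_left_mono) auto
    then show ?thesis using F(1) by (smt (verit) zero_le_power2)
  qed
  then have "(2 * a * N)\<^sup>2 \<le> F\<^sup>2" using nonneg N by (intro power_mono) auto
  also have "F\<^sup>2 \<le> F * (\<epsilon>\<^sup>2 * l\<^sup>2)"
    using F(2) F0 by (simp add: power2_eq_square mult_left_mono)
  also have "\<dots> \<le> F * (\<epsilon>\<^sup>2 * ((3 + 2 * sqrt 2) * a\<^sup>2))"
    using la F0 by (intro mult_left_mono) auto
  finally have "4 * N\<^sup>2 * a\<^sup>2 \<le> (3 + 2 * sqrt 2) * \<epsilon>\<^sup>2 * F * a\<^sup>2"
    by (simp add: power_mult_distrib mult_ac)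
  then have "4 * N\<^sup>2 \<le> (3 + 2 * sqrt 2) * \<epsilon>\<^sup>2 * F"
    using a by (simp add: mult_le_cancel_right)
  then show ?thesis by simp
qed

text \<open>
  With \<open>Y = P Z\<close> and \<open>W = (1 - P) Z\<close>, the blocks of \<open>E = X X\<^sup>T - Z Z\<^sup>T\<close> outside \<open>P E P\<close> do not
  involve \<open>X\<close>: they are \<open>- Y W\<^sup>T\<close>, its transpose, and \<open>- W W\<^sup>T\<close>. The first two have norm at least
  \<open>\<surd>a \<parallel>W\<parallel>\<close>, where \<open>a\<close> is the least value of \<open>\<parallel>Y v\<parallel>\<^sup>2\<close> on unit vectors \<open>v\<close>; this forces \<open>W\<close>, and to second order \<open>W W\<^sup>T\<close>, to be small compared with \<open>E\<close>. A rank-deficient \<open>X\<close>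
  is covered as well: if \<open>P\<close> projects onto its column space then \<open>Y\<close> would not be injective, so
  \<open>a = 0\<close>, against \<open>a\<^sup>2 \<ge> l\<^sup>2 - \<parallel>E\<parallel>\<^sup>2 > 0\<close>.
\<close>

lemma normal_component_bound:
  fixes X Z :: "real^'r^'n" and P :: "real^'n^'n"
  assumes P: "transpose P = P" "P ** P = P" "P ** X = X"
    and l: "0 < l" and Z: "\<And>v. l * (norm v)\<^sup>2 \<le> (norm (Z *v v))\<^sup>2"
    and close: "norm (X ** transpose X - Z ** transpose Z) \<le> \<epsilon> * l"
    and eps: "0 < \<epsilon>" "\<epsilon> \<le> 2 * (sqrt 2 - 1)"
  shows "(norm ((mat 1 - P) ** (Z ** transpose Z) ** (mat 1 - P)))\<^sup>2
    \<le> (3 + 2 * sqrt 2) / 4 * \<epsilon>\<^sup>2 * (norm (X ** transpose X - Z ** transpose Z))\<^sup>2"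
proof -
  let ?E = "X ** transpose X - Z ** transpose Z"
  let ?P' = "mat 1 - P"
  define Y where "Y = P ** Z"
  define W where "W = ?P' ** Z"
  have P': "transpose ?P' = ?P'" by (simp add: transpose_matrix_diff P)
  have tW: "transpose W = transpose Z ** ?P'" by (simp add: W_def matrix_transpose_mul P')
  have C: "?P' ** (Z ** transpose Z) ** ?P' = W ** transpose W"
    unfolding tW by (simp add: W_def matrix_mul_assoc)
  have "transpose X ** ?P' = 0"
    using P by (metis P' matrix_mult.diff_left diff_self matrix_mul_lid matrix_transpose_mul
        transpose_matrix_zero)
  then have EP': "?E ** ?P' = - (Z ** transpose W)"
    by (simp add: matrix_mult.diff_left tW flip: matrix_mul_assoc)
  have "(norm ?E)\<^sup>2 = (norm (transpose ?E))\<^sup>2" by (simp add: norm_transpose_matrix)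
  also have "\<dots> = (norm (P ** transpose ?E))\<^sup>2 + (norm (?P' ** transpose ?E))\<^sup>2"
    by (rule pythagoras_projection[OF P(1,2)])
  also have "?P' ** transpose ?E = transpose (?E ** ?P')"
    by (simp add: matrix_transpose_mul P')
  also have "P ** transpose ?E = transpose (?E ** P)"
    by (simp add: matrix_transpose_mul P)
  finally have "(norm ?E)\<^sup>2 = (norm (?E ** P))\<^sup>2 + (norm (Z ** transpose W))\<^sup>2"
    by (simp add: norm_transpose_matrix EP')
  moreover have "(norm (Z ** transpose W))\<^sup>2 = (norm (Y ** transpose W))\<^sup>2 + (norm (W ** transpose W))\<^sup>2"
    using pythagoras_projection[OF P(1,2), of "Z ** transpose W"]
    by (simp add: Y_def W_def matrix_mul_assoc)
  moreover have "(norm (Y ** transpose W))\<^sup>2 \<le> (norm (?E ** P))\<^sup>2"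
  proof -
    have "?P' ** ?E ** P = transpose (P ** (?E ** ?P'))"
      by (simp add: matrix_transpose_mul P' P transpose_matrix_diff matrix_mul_assoc)
    also have "P ** (?E ** ?P') = - (Y ** transpose W)"
      by (simp add: EP' Y_def matrix_mult.minus_right matrix_mul_assoc)
    finally have "norm (?P' ** (?E ** P)) = norm (Y ** transpose W)"
      by (simp add: transpose_matrix_minus norm_transpose_matrix matrix_mul_assoc)
    then show ?thesis
      using pythagoras_projection[OF P(1,2), of "?E ** P"] by simp
  qed
  ultimately have E2: "2 * (norm (Y ** transpose W))\<^sup>2 + (norm (W ** transpose W))\<^sup>2 \<le> (norm ?E)\<^sup>2"
    by simp
  obtain v where v: "norm v = 1" "\<And>w. (norm (Y *v v))\<^sup>2 * (norm w)\<^sup>2 \<le> (norm (Y *v w))\<^sup>2"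
    using minimal_stretch_attained[of Y] by blast
  have YW: "(norm (Y *v v))\<^sup>2 * (norm W)\<^sup>2 \<le> (norm (Y ** transpose W))\<^sup>2"
    using norm_matrix_mult_ge[OF v(2), of "transpose W"] by (simp add: norm_transpose_matrix)
  show ?thesis unfolding C
  proof (rule normal_component_numeric[where a = "(norm (Y *v v))\<^sup>2" and c = "(norm (W *v v))\<^sup>2"
        and T = "(norm W)\<^sup>2" and l = l])
    show "l \<le> (norm (Y *v v))\<^sup>2 + (norm (W *v v))\<^sup>2"
      using Z[of v] v(1) pythagoras_projection_vector[OF P(1,2), of "Z *v v"]
      by (simp add: Y_def W_def matrix_vector_mul_assoc)
    show "(norm (W *v v))\<^sup>2 \<le> norm (W ** transpose W)"
      using norm_sq_matrix_vector_le[of W v] v(1) by simp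
    show "norm (W ** transpose W) \<le> (norm W)\<^sup>2"
      using norm_matrix_mult_le[of W "transpose W"] by (simp add: norm_transpose_matrix power2_eq_square)
    show "2 * (norm (Y *v v))\<^sup>2 * (norm W)\<^sup>2 + (norm (W ** transpose W))\<^sup>2 \<le> (norm ?E)\<^sup>2"
      using E2 YW by simp
    show "(norm ?E)\<^sup>2 \<le> \<epsilon>\<^sup>2 * l\<^sup>2"
      using power_mono[OF close, of 2] by (simp add: power_mult_distrib)
    have "\<epsilon>\<^sup>2 \<le> (2 * (sqrt 2 - 1))\<^sup>2" using eps by (intro power_mono) auto
    then show "\<epsilon>\<^sup>2 \<le> 4 * (3 - 2 * sqrt 2)"
      by (simp add: power2_eq_square algebra_simps)
  qed (use l in auto)
qed

text \<open>
  The left side is \<open>P E + E P - P E P\<close>. Splitting the last term evenly between the first two makes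
  them transposes of each other, and the first has the form \<open>X V\<close> because \<open>P = X L\<close>.
\<close>

lemma tangential_difference:
  fixes X :: "real^'r^'n" and P E :: "real^'n^'n" and L :: "real^'n^'r"
  assumes P: "P = X ** L" "transpose P = P" and E: "transpose E = E"
  obtains U :: "real^'r^'n"
    where "E - (mat 1 - P) ** E ** (mat 1 - P) = X ** transpose U + U ** transpose X"
proof -
  define V where "V = L ** E - (1/2) *\<^sub>R (L ** E ** P)"
  have XV: "X ** V = P ** E - (1/2) *\<^sub>R (P ** E ** P)"
    by (simp add: V_def P(1) matrix_mult.diff_right matrix_mult.scaleR_right matrix_mul_assoc)
  have "transpose V ** transpose X = transpose (X ** V)" by (simp add: matrix_transpose_mul)
  also have "\<dots> = E ** P - (1/2) *\<^sub>R (P ** E ** P)"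
    unfolding XV
    by (simp add: transpose_matrix_diff transpose_scalar matrix_transpose_mul P(2) E matrix_mul_assoc)
  finally have VX: "transpose V ** transpose X = E ** P - (1/2) *\<^sub>R (P ** E ** P)" .
  have "(1/2) *\<^sub>R M + (1/2) *\<^sub>R M = M" for M :: "real^'n^'n"
    by (simp flip: scaleR_add_left)
  then have "E - (mat 1 - P) ** E ** (mat 1 - P) = X ** V + transpose V ** transpose X"
    unfolding XV VX
    by (simp add: matrix_mult.diff_left matrix_mult.diff_right algebra_simps)
  then show ?thesis using that[of "transpose V"] by simp
qed

section \<open>First and second derivatives\<close>

lemma has_real_derivative_along_line:
  assumes "\<And>x. (f has_derivative blinfun_apply (f' x)) (at x)"
  shows "((\<lambda>t. f (x + t *\<^sub>R u)) has_real_derivative f' (x + t *\<^sub>R u) u) (at t)"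
proof -
  have "((\<lambda>t. x + t *\<^sub>R u) has_derivative (\<lambda>h. h *\<^sub>R u)) (at t)"
    by (auto intro!: derivative_eq_intros)
  from has_derivative_compose[OF this assms]
  show ?thesis
    unfolding has_field_derivative_def
    by (rule has_derivative_eq_rhs) (simp add: fun_eq_iff blinfun.scaleR_right)
qed

lemma has_real_derivative_blinfun_along_line:
  fixes g :: "'a::real_normed_vector \<Rightarrow> 'a \<Rightarrow>\<^sub>L real"
  assumes "\<And>x. (g has_derivative blinfun_apply (g' x)) (at x)"
  shows "((\<lambda>t. g (x + t *\<^sub>R u) w) has_real_derivative g' (x + t *\<^sub>R u) u w) (at t)"
proof -
  have "((\<lambda>t. x + t *\<^sub>R u) has_derivative (\<lambda>h. h *\<^sub>R u)) (at t)"
    by (auto intro!: derivative_eq_intros)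
  from has_derivative_compose[OF this assms]
  have "((\<lambda>t. g (x + t *\<^sub>R u)) has_derivative (\<lambda>h. g' (x + t *\<^sub>R u) (h *\<^sub>R u))) (at t)" .
  then have "((\<lambda>t. g (x + t *\<^sub>R u) w) has_derivative (\<lambda>h. g' (x + t *\<^sub>R u) (h *\<^sub>R u) w)) (at t)"
    by (auto intro!: derivative_eq_intros)
  then show ?thesis
    unfolding has_field_derivative_def
    by (rule has_derivative_eq_rhs) (simp add: fun_eq_iff blinfun.scaleR_right blinfun.scaleR_left)
qed

text \<open>
  The second difference over a parallelogram is an increment of an increment; the mean value theorem
  applies first along \<open>u\<close> and then along \<open>v\<close>.
\<close>

lemma second_difference_mean_value:
  assumes f': "\<And>x. (f has_derivative blinfun_apply (f' x)) (at x)"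
    and f'': "\<And>x. (f' has_derivative blinfun_apply (f'' x)) (at x)" and h: "0 < h"
  shows "\<exists>s t. 0 < s \<and> s < h \<and> 0 < t \<and> t < h \<and>
    f (x + h *\<^sub>R u + h *\<^sub>R v) - f (x + h *\<^sub>R u) - f (x + h *\<^sub>R v) + f x
      = h * h * f'' (x + s *\<^sub>R u + t *\<^sub>R v) v u"
proof -
  let ?\<phi> = "\<lambda>s. f (x + h *\<^sub>R v + s *\<^sub>R u) - f (x + s *\<^sub>R u)"
  have "\<exists>s>0. s < h \<and> ?\<phi> h - ?\<phi> 0 = (h - 0) * (f' (x + h *\<^sub>R v + s *\<^sub>R u) u - f' (x + s *\<^sub>R u) u)"
    by (rule MVT2[OF h]) (intro DERIV_diff has_real_derivative_along_line f')
  then obtain s where s: "0 < s" "s < h"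
    "?\<phi> h - ?\<phi> 0 = h * (f' (x + h *\<^sub>R v + s *\<^sub>R u) u - f' (x + s *\<^sub>R u) u)" by auto
  let ?\<psi> = "\<lambda>t. f' (x + s *\<^sub>R u + t *\<^sub>R v) u"
  have "\<exists>t>0. t < h \<and> ?\<psi> h - ?\<psi> 0 = (h - 0) * f'' (x + s *\<^sub>R u + t *\<^sub>R v) v u"
    by (rule MVT2[OF h]) (rule has_real_derivative_blinfun_along_line[OF f''])
  then obtain t where t: "0 < t" "t < h" "?\<psi> h - ?\<psi> 0 = h * f'' (x + s *\<^sub>R u + t *\<^sub>R v) v u" by auto
  have "?\<phi> h - ?\<phi> 0 = h * h * f'' (x + s *\<^sub>R u + t *\<^sub>R v) v u"
    using s(3) t(3) by (simp add: add_ac)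
  then show ?thesis using s t by (intro exI[of _ s] exI[of _ t]) (simp add: algebra_simps)
qed

text \<open>
  The second difference is symmetric in \<open>u\<close> and \<open>v\<close>, so the mean value lemma, used in both orders,
  gives points arbitrarily close to \<open>x\<close> where the two mixed values agree; continuity carries this over
  to \<open>x\<close>.
\<close>

lemma second_derivative_symmetric:
  fixes f :: "'a::real_normed_vector \<Rightarrow> real"
  assumes f': "\<And>x. (f has_derivative blinfun_apply (f' x)) (at x)"
    and f'': "\<And>x. (f' has_derivative blinfun_apply (f'' x)) (at x)"
    and cont: "continuous_on UNIV f''"
  shows "f'' x u v = f'' x v u"
proof -
  let ?h = "\<lambda>n. inverse (real (Suc n))"
  \<comment> \<open>At scale \<open>1 / (n + 1)\<close> both orders of differentiation produce a point within
    \<open>(\<parallel>u\<parallel> + \<parallel>v\<parallel>) / (n + 1)\<close> of \<open>x\<close>.\<close>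
  have "\<exists>p q. dist p x \<le> ?h n * (norm u + norm v) \<and> dist q x \<le> ?h n * (norm u + norm v)
      \<and> f'' p u v = f'' q v u" for n
  proof -
    have h: "0 < ?h n" by simp
    have near: "dist (x + s *\<^sub>R a + t *\<^sub>R b) x \<le> ?h n * (norm a + norm b)"
      if "0 < s" "s < ?h n" "0 < t" "t < ?h n" for s t and a b :: 'a
    proof -
      have "dist (x + s *\<^sub>R a + t *\<^sub>R b) x = norm (s *\<^sub>R a + t *\<^sub>R b)"
        by (simp add: dist_norm add_ac)
      also have "\<dots> \<le> s * norm a + t * norm b"
        using norm_triangle_ineq[of "s *\<^sub>R a" "t *\<^sub>R b"] that by simp
      also have "\<dots> \<le> ?h n * norm a + ?h n * norm b"
        using that by (intro add_mono mult_right_mono) auto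
      finally show ?thesis by (simp only: distrib_left)
    qed
    obtain s t where q: "0 < s" "s < ?h n" "0 < t" "t < ?h n"
      "f (x + ?h n *\<^sub>R u + ?h n *\<^sub>R v) - f (x + ?h n *\<^sub>R u) - f (x + ?h n *\<^sub>R v) + f x
        = ?h n * ?h n * f'' (x + s *\<^sub>R u + t *\<^sub>R v) v u"
      using second_difference_mean_value[OF f' f'' h] by blast
    obtain s' t' where p: "0 < s'" "s' < ?h n" "0 < t'" "t' < ?h n"
      "f (x + ?h n *\<^sub>R v + ?h n *\<^sub>R u) - f (x + ?h n *\<^sub>R v) - f (x + ?h n *\<^sub>R u) + f x
        = ?h n * ?h n * f'' (x + s' *\<^sub>R v + t' *\<^sub>R u) u v"
      using second_difference_mean_value[OF f' f'' h] by blast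
    have "f (x + ?h n *\<^sub>R v + ?h n *\<^sub>R u) - f (x + ?h n *\<^sub>R v) - f (x + ?h n *\<^sub>R u) + f x
        = f (x + ?h n *\<^sub>R u + ?h n *\<^sub>R v) - f (x + ?h n *\<^sub>R u) - f (x + ?h n *\<^sub>R v) + f x"
      by (simp add: add_ac)
    then have "(?h n * ?h n) * f'' (x + s' *\<^sub>R v + t' *\<^sub>R u) u v
        = (?h n * ?h n) * f'' (x + s *\<^sub>R u + t *\<^sub>R v) v u"
      using p(5) q(5) by (metis (no_types))
    then have "f'' (x + s' *\<^sub>R v + t' *\<^sub>R u) u v = f'' (x + s *\<^sub>R u + t *\<^sub>R v) v u"
      using h by (simp only: mult_cancel_left) simp
    then show ?thesis
      using near[OF p(1-4), of v u] near[OF q(1-4), of u v] by (metis add.commute)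
  qed
  then obtain p q where pq: "\<And>n. dist (p n) x \<le> ?h n * (norm u + norm v)"
    "\<And>n. dist (q n) x \<le> ?h n * (norm u + norm v)" "\<And>n. f'' (p n) u v = f'' (q n) v u"
    by metis
  have "(\<lambda>n. ?h n * (norm u + norm v)) \<longlonglongrightarrow> 0"
    using tendsto_mult_left_zero[OF LIMSEQ_inverse_real_of_nat] .
  then have p: "p \<longlonglongrightarrow> x" and q: "q \<longlonglongrightarrow> x"
    using pq(1,2) by (auto intro!: metric_tendsto_imp_tendsto[of _ 0 _ _ x] simp: dist_norm)
  have at: "isCont f'' x" using cont by (simp add: continuous_on_eq_continuous_at)
  have "(\<lambda>n. f'' (p n) u v) \<longlonglongrightarrow> f'' x u v"
    by (intro tendsto_intros isCont_tendsto_compose[OF at] p)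
  moreover have "(\<lambda>n. f'' (q n) v u) \<longlonglongrightarrow> f'' x v u"
    by (intro tendsto_intros isCont_tendsto_compose[OF at] q)
  ultimately show ?thesis using pq(3) LIMSEQ_unique by simp
qed

lemma matrix_eq_sum_units:
  fixes K :: "real^'n^'m"
  shows "K = (\<Sum>i\<in>UNIV. \<Sum>j\<in>UNIV. K $ i $ j *\<^sub>R axis i (axis j 1))"
proof -
  have "(\<Sum>i\<in>UNIV. \<Sum>j\<in>UNIV. K $ i $ j *\<^sub>R axis i (axis j 1)) $ a $ b
      = (\<Sum>i\<in>UNIV. \<Sum>j\<in>UNIV. if j = b then if i = a then K $ a $ b else 0 else 0)" for a b
    unfolding sum_component vector_scaleR_component by (intro sum.cong refl) (auto simp: axis_def)
  then show ?thesis by (simp add: vec_eq_iff)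
qed

text \<open>
  Mean value arguments act on the second Frechet derivative, the isometry bounds on the coordinate
  Hessian.
\<close>

lemma hessian_eq_second_derivative:
  fixes f :: "real^'n^'n \<Rightarrow> real"
  assumes f': "\<And>x. (f has_derivative blinfun_apply (f' x)) (at x)"
    and f'': "\<And>x. (f' has_derivative blinfun_apply (f'' x)) (at x)"
  shows "hessian f M K L = f'' M K L"
proof -
  let ?e = "\<lambda>i j. axis i (axis j 1) :: real^'n^'n"
  have "entry_deriv k l f = (\<lambda>M. f' M (?e k l))" for k l
    using has_real_derivative_along_line[OF f', of _ _ 0]
    by (auto simp: entry_deriv_def fun_eq_iff intro!: DERIV_imp_deriv)
  then have entry: "entry_deriv i j (entry_deriv k l f) M = f'' M (?e i j) (?e k l)" for i j k l
    using has_real_derivative_blinfun_along_line[OF f'', of M _ "?e k l" 0]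
    by (auto simp: entry_deriv_def[of i j] intro!: DERIV_imp_deriv)
  have left: "f'' M K L = (\<Sum>i\<in>UNIV. \<Sum>j\<in>UNIV. K $ i $ j * f'' M (?e i j) L)"
    by (subst matrix_eq_sum_units[of K])
      (simp add: blinfun.sum_left blinfun.sum_right blinfun.scaleR_left blinfun.scaleR_right)
  have right: "f'' M (?e i j) L = (\<Sum>k\<in>UNIV. \<Sum>l\<in>UNIV. L $ k $ l * f'' M (?e i j) (?e k l))" for i j
    by (subst matrix_eq_sum_units[of L]) (simp add: blinfun.sum_right blinfun.scaleR_right)
  show ?thesis unfolding left hessian_def entry
    by (subst right) (simp add: sum_distrib_left mult_ac)
qed

lemma local_minimizer_derivative_zero:
  fixes \<phi> :: "real \<Rightarrow> real"
  assumes "local_minimizer \<phi> x" and "(\<phi> has_real_derivative l) (at x)"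
  shows "l = 0"
proof -
  obtain d where "0 < d" "\<forall>y. dist y x < d \<longrightarrow> \<phi> x \<le> \<phi> y"
    using assms(1) by (auto simp: local_minimizer_def eventually_nhds_metric)
  then show ?thesis
    using DERIV_local_min[OF assms(2), of d] by (simp add: dist_real_def abs_minus_commute)
qed

lemma local_minimizer_compose:
  assumes "local_minimizer g (c t)" and "isCont c t"
  shows "local_minimizer (\<lambda>s. g (c s)) t"
proof -
  have "filterlim c (nhds (c t)) (nhds t)"
    using assms(2) by (simp add: continuous_within tendsto_at_iff_tendsto_nhds)
  then show ?thesis using assms(1)
    unfolding local_minimizer_def by (auto dest: eventually_compose_filterlim)
qed


text \<open>
  Along the line \<open>X + t U\<close> the matrix \<open>Y Y\<^sup>T\<close> moves with velocity \<open>X U\<^sup>T + U X\<^sup>T\<close> at \<open>t = 0\<close>.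
\<close>

lemma gram_map_stationary:
  fixes f :: "real^'n^'n \<Rightarrow> real" and X U :: "real^'r^'n"
  assumes f': "\<And>x. (f has_derivative blinfun_apply (f' x)) (at x)"
    and loc: "local_minimizer (\<lambda>Y :: real^'r^'n. f (Y ** transpose Y)) X"
  shows "f' (X ** transpose X) (X ** transpose U + U ** transpose X) = 0"
proof -
  let ?K = "X ** transpose U + U ** transpose X"
  have line: "((\<lambda>t. X + t *\<^sub>R U) has_derivative (\<lambda>h. h *\<^sub>R U)) (at 0)"
    by (auto intro!: derivative_eq_intros)
  have "((\<lambda>t. transpose (X + t *\<^sub>R U)) has_derivative (\<lambda>h. transpose (h *\<^sub>R U))) (at 0)"
    using bounded_linear.has_derivative[OF linear_conv_bounded_linear[THEN iffD1, OF linear_transpose_matrix] line] .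
  from matrix_mult.FDERIV[OF line this]
  have "((\<lambda>t. (X + t *\<^sub>R U) ** transpose (X + t *\<^sub>R U)) has_derivative (\<lambda>h. h *\<^sub>R ?K)) (at 0)"
    by (rule has_derivative_eq_rhs)
      (simp add: fun_eq_iff transpose_scalar matrix_mult.scaleR_right matrix_mult.scaleR_left scaleR_add_right)
  from has_derivative_compose[OF this f']
  have "((\<lambda>t. f ((X + t *\<^sub>R U) ** transpose (X + t *\<^sub>R U))) has_real_derivative f' (X ** transpose X) ?K) (at 0)"
    unfolding has_field_derivative_def
    by (rule has_derivative_eq_rhs) (simp add: fun_eq_iff blinfun.scaleR_right)
  moreover have "local_minimizer (\<lambda>t. f ((X + t *\<^sub>R U) ** transpose (X + t *\<^sub>R U))) 0"
    using loc by (intro local_minimizer_compose[where c = "\<lambda>t. X + t *\<^sub>R U"]) simp_all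
  ultimately show ?thesis using local_minimizer_derivative_zero by blast
qed

lemma global_minimizer_derivative_zero:
  fixes f :: "'a::real_normed_vector \<Rightarrow> real"
  assumes f': "\<And>x. (f has_derivative blinfun_apply (f' x)) (at x)" and "global_minimizer f x"
  shows "f' x u = 0"
proof -
  have "local_minimizer (\<lambda>t. f (x + t *\<^sub>R u)) 0"
    using assms(2) by (simp add: local_minimizer_def global_minimizer_def)
  then show ?thesis
    using local_minimizer_derivative_zero has_real_derivative_along_line[OF f', of x u 0] by fastforce
qed

section \<open>Restricted isometry on a plane of low-rank matrices\<close>

text \<open>
  A Wielandt-type inequality. For the normalized vectors \<open>e\<close> and \<open>k\<close> in the directions of \<open>E\<close> and \<open>K\<close>,
  orthogonality for \<open>H\<close> gives \<open>H (e + k) (e + k) = H (e - k) (e - k)\<close>. The lower bound on the left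
  and the upper bound on the right yield \<open>(1 - \<delta>) (2 + 2c) \<le> (1 + \<delta>) (2 - 2c)\<close> for the cosine \<open>c\<close>, that
  is \<open>c \<le> \<delta>\<close>.
\<close>

lemma restricted_cosine_bound:
  fixes E K :: "'a::real_inner" and H :: "'a \<Rightarrow>\<^sub>L 'a \<Rightarrow>\<^sub>L real"
  assumes zero: "H E K = 0" "H K E = 0" and nz: "E \<noteq> 0" "K \<noteq> 0"
    and bounds: "\<And>a b. (1 - \<delta>) * (norm (a *\<^sub>R E + b *\<^sub>R K))\<^sup>2 \<le> H (a *\<^sub>R E + b *\<^sub>R K) (a *\<^sub>R E + b *\<^sub>R K)"
      "\<And>a b. H (a *\<^sub>R E + b *\<^sub>R K) (a *\<^sub>R E + b *\<^sub>R K) \<le> (1 + \<delta>) * (norm (a *\<^sub>R E + b *\<^sub>R K))\<^sup>2"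
  shows "E \<bullet> K \<le> \<delta> * (norm E * norm K)"
proof -
  let ?a = "1 / norm E" and ?b = "1 / norm K"
  define c where "c = E \<bullet> K / (norm E * norm K)"
  have H: "H (?a *\<^sub>R E + b *\<^sub>R K) (?a *\<^sub>R E + b *\<^sub>R K) = ?a\<^sup>2 * H E E + b\<^sup>2 * H K K" for b
    using zero by (simp add: blinfun.add_left blinfun.add_right blinfun.scaleR_left
        blinfun.scaleR_right power2_eq_square)
  have norms: "(norm (?a *\<^sub>R E + s *\<^sub>R K))\<^sup>2 = 2 + 2 * (s * norm K) * c" if "s\<^sup>2 = ?b\<^sup>2" for s
  proof -
    have "(norm (?a *\<^sub>R E + s *\<^sub>R K))\<^sup>2 = ?a\<^sup>2 * (norm E)\<^sup>2 + s\<^sup>2 * (norm K)\<^sup>2 + 2 * ?a * s * (E \<bullet> K)"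
      unfolding power2_norm_eq_inner
      by (simp add: inner_add_left inner_add_right inner_commute[of K E] power2_eq_square algebra_simps)
    then show ?thesis using that nz by (simp add: c_def power_divide)
  qed
  have "(1 - \<delta>) * (2 + 2 * c) \<le> ?a\<^sup>2 * H E E + ?b\<^sup>2 * H K K"
    using bounds(1)[of ?a ?b] norms[of ?b] nz by (simp only: H) simp
  also have "\<dots> \<le> (1 + \<delta>) * (2 - 2 * c)"
    using bounds(2)[of ?a "- ?b"] norms[of "- ?b"] nz by (simp only: H) simp
  finally have "c \<le> \<delta>" by (simp add: algebra_simps)
  then show ?thesis using nz by (simp add: c_def field_simps)
qed

lemma rank_sum_le:
  fixes X :: "real^'r^'n" and A :: "real^'n^'n" and V :: "real^'n^'r" and B :: "real^'n^'n"
  shows "rank (X ** V + A ** B) \<le> CARD('r) + rank A"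
proof -
  let ?S = "{x + y |x y. x \<in> range ((*v) X) \<and> y \<in> range ((*v) A)}"
  have sub: "subspace (range ((*v) X))" "subspace (range ((*v) A))"
    using linear_subspace_image[OF matrix_vector_mul_linear subspace_UNIV] by blast+
  have "(X ** V + A ** B) *v w \<in> ?S" for w
    by (auto simp: matrix_vector_mult_add_rdistrib simp flip: matrix_vector_mul_assoc)
  then have "rank (X ** V + A ** B) \<le> dim ?S"
    unfolding rank_dim_range by (intro dim_subset) auto
  also have "\<dots> \<le> dim (range ((*v) X)) + dim (range ((*v) A))"
    using dim_sums_Int[OF sub] by linarith
  also have "dim (range ((*v) X)) \<le> CARD('r)"
    using rank_bound[of X] by (simp add: rank_dim_range)
  finally show ?thesis by (simp add: rank_dim_range)
qed

text \<open>
  The shape in which the restricted isometry property is used: the base point and the directions all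
  have their column space inside that of \<open>X\<close> plus that of \<open>A\<close>.
\<close>

lemma rank_mixture_le:
  fixes X :: "real^'r^'n" and A D :: "real^'n^'n" and V :: "real^'n^'r"
  assumes "rank A \<le> CARD('r)"
  shows "rank (a *\<^sub>R A + b *\<^sub>R (X ** U + A ** B) + c *\<^sub>R (X ** V + A ** D)) \<le> 2 * CARD('r)"
proof -
  have "a *\<^sub>R A + b *\<^sub>R (X ** U + A ** B) + c *\<^sub>R (X ** V + A ** D)
      = X ** (b *\<^sub>R U + c *\<^sub>R V) + A ** (a *\<^sub>R mat 1 + b *\<^sub>R B + c *\<^sub>R D)"
    by (simp add: matrix_mult.add_right matrix_mult.scaleR_right algebra_simps)
  also have "rank \<dots> \<le> CARD('r) + rank A" by (rule rank_sum_le)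
  finally show ?thesis using assms by simp
qed

section \<open>Absence of spurious local minimizers near the ground truth\<close>

theorem theorem10:
  fixes f :: "real^'n^'n \<Rightarrow> real"
    and Mstar :: "real^'n^'n"
    and \<epsilon> \<delta> :: real
  assumes "CARD('r::finite) \<le> CARD('n::finite)"
    and "twice_continuously_differentiable f"
    and "psd_matrix Mstar"
    and "rank Mstar \<le> CARD('r)"
    and "global_minimizer f Mstar"
    and "0 < \<epsilon>" and "\<epsilon> \<le> 2 * (sqrt 2 - 1)"
    and "0 \<le> \<delta>" and "\<delta> < 1"
    and "restricted_isometry \<delta> (2 * CARD('r)) f"
    and "\<delta> < sqrt (1 - (3 + 2 * sqrt 2) / 4 * \<epsilon>\<^sup>2)"
  shows "\<not> (\<exists>X :: real^'r^'n.
           spurious_local_minimizer (\<lambda>Y :: real^'r^'n. f (Y ** transpose Y)) X \<and>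
           norm (X ** transpose X - Mstar) \<le> \<epsilon> * eigenvalue_desc Mstar (CARD('r)))"
proof
  assume "\<exists>X :: real^'r^'n.
           spurious_local_minimizer (\<lambda>Y :: real^'r^'n. f (Y ** transpose Y)) X \<and>
           norm (X ** transpose X - Mstar) \<le> \<epsilon> * eigenvalue_desc Mstar (CARD('r))"
  then obtain X :: "real^'r^'n"
    where loc: "local_minimizer (\<lambda>Y :: real^'r^'n. f (Y ** transpose Y)) X"
      and not_global: "\<not> global_minimizer (\<lambda>Y :: real^'r^'n. f (Y ** transpose Y)) X"
      and close: "norm (X ** transpose X - Mstar) \<le> \<epsilon> * eigenvalue_desc Mstar (CARD('r))"
    unfolding spurious_local_minimizer_def by blast
  define E where "E = X ** transpose X - Mstar"
  have E_nz: "E \<noteq> 0"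
    using not_global assms(5) by (auto simp: E_def global_minimizer_def)
  have symM: "transpose Mstar = Mstar" using assms(3) by (simp add: psd_matrix_def)
  have symE: "transpose E = E"
    by (simp add: E_def transpose_matrix_diff matrix_transpose_mul symM)
  have "0 < norm E" using E_nz by simp
  \<comment> \<open>The closeness assumption can hold with \<open>E \<noteq> 0\<close> only for positive \<open>\<lambda>\<^sub>r(M*)\<close>.\<close>
  then have "0 < \<epsilon> * eigenvalue_desc Mstar (CARD('r))" using close unfolding E_def by linarith
  then have l: "0 < eigenvalue_desc Mstar (CARD('r))" using assms(6) by (simp add: zero_less_mult_iff)
  obtain Z :: "real^'r^'n" where Z: "Mstar = Z ** transpose Z"
      "\<And>v. eigenvalue_desc Mstar (CARD('r)) * (norm v)\<^sup>2 \<le> (norm (Z *v v))\<^sup>2"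
    using symmetric_low_rank_factorization[OF symM assms(4,1) l] by blast
  obtain L :: "real^'n^'r" where L: "transpose (X ** L) = X ** L"
      "(X ** L) ** (X ** L) = X ** L" "(X ** L) ** X = X"
    using column_space_projection[of X] by blast
  define P where "P = X ** L"
  let ?P' = "mat 1 - P"
  note P = L[folded P_def]
  have symP': "transpose ?P' = ?P'" and P'2: "?P' ** ?P' = ?P'"
    by (simp_all add: transpose_matrix_diff P matrix_mult.diff_left matrix_mult.diff_right)
  define C where "C = ?P' ** Mstar ** ?P'"
  define K where "K = E + C"
  have "?P' ** X = 0" by (simp add: matrix_mult.diff_left P)
  then have C_E: "C = - (?P' ** E ** ?P')"
    by (simp add: C_def E_def matrix_mult.diff_right matrix_mult.diff_left matrix_mul_assoc)
  obtain U where U: "K = X ** transpose U + U ** transpose X"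
    using tangential_difference[OF P_def P(1) symE] C_E by (auto simp: K_def)

  have "(norm C)\<^sup>2 \<le> (3 + 2 * sqrt 2) / 4 * \<epsilon>\<^sup>2 * (norm E)\<^sup>2"
    using normal_component_bound[OF P l Z(2) _ assms(6,7)]
    using close by (simp add: C_def E_def Z(1))
  moreover have EC: "E \<bullet> C = - (norm C)\<^sup>2"
  proof -
    have "C = ?P' ** C ** ?P'"
      unfolding C_def by (metis P'2 matrix_mul_assoc)
    then have "C \<bullet> E = (?P' ** C ** ?P') \<bullet> E" by simp
    also have "\<dots> = C \<bullet> (?P' ** (E ** ?P'))"
      by (simp only: inner_matrix_mult_left[of ?P'] inner_matrix_mult_right[of _ ?P'] symP')
    also have "?P' ** (E ** ?P') = - C" by (simp add: C_E matrix_mul_assoc)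
    finally show ?thesis by (simp add: power2_norm_eq_inner inner_commute)
  qed
  then have EK: "E \<bullet> K = (norm K)\<^sup>2" and K2: "(norm K)\<^sup>2 = (norm E)\<^sup>2 - (norm C)\<^sup>2"
    by (simp_all add: K_def power2_norm_eq_inner inner_add_left inner_add_right inner_commute[of C E])
  ultimately have "(1 - (3 + 2 * sqrt 2) / 4 * \<epsilon>\<^sup>2) * (norm E)\<^sup>2 \<le> (norm K)\<^sup>2"
    by (simp add: left_diff_distrib)
  then have "sqrt (1 - (3 + 2 * sqrt 2) / 4 * \<epsilon>\<^sup>2) * norm E \<le> norm K"
    using real_sqrt_le_mono by (fastforce simp: real_sqrt_mult)
  then have cos: "\<delta> * norm E < norm K"
    using assms(11) mult_strict_right_mono[OF assms(11) \<open>0 < norm E\<close>] by linarith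
  moreover have "0 \<le> \<delta> * norm E" using assms(8) by simp
  ultimately have "0 < norm K" by linarith
  then have K_nz: "K \<noteq> 0" by simp

  \<comment> \<open>Rolle's theorem for \<open>t \<mapsto> f' (M* + t E) K\<close>, which vanishes at both ends of the unit interval.\<close>
  obtain f' f'' where f': "\<And>x. (f has_derivative blinfun_apply (f' x)) (at x)"
      and f'': "\<And>x. (f' has_derivative blinfun_apply (f'' x)) (at x)" and cont: "continuous_on UNIV f''"
    using assms(2) unfolding twice_continuously_differentiable_def by blast
  have "f' (Mstar + 0 *\<^sub>R E) K = 0"
    using global_minimizer_derivative_zero[OF f' assms(5)] by simp
  moreover have "f' (Mstar + 1 *\<^sub>R E) K = 0"
    using gram_map_stationary[OF f' loc, of U] by (simp add: U E_def)
  moreover have "\<exists>t>0. t < 1 \<and>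
      f' (Mstar + 1 *\<^sub>R E) K - f' (Mstar + 0 *\<^sub>R E) K = (1 - 0) * f'' (Mstar + t *\<^sub>R E) E K"
    by (rule MVT2) (simp_all only: zero_less_one has_real_derivative_blinfun_along_line[OF f''])
  ultimately obtain t where zero: "f'' (Mstar + t *\<^sub>R E) E K = 0" by auto
  then have zero': "f'' (Mstar + t *\<^sub>R E) K E = 0"
    using second_derivative_symmetric[OF f' f'' cont] by simp

  \<comment> \<open>The base point and both directions written as combinations \<open>X V + M* B\<close>, for the rank bounds.\<close>
  have E_form: "E = X ** transpose X + Mstar ** (- mat 1)"
    by (simp add: E_def matrix_mult.minus_right)
  have K_form: "K = X ** (transpose X - L ** (Mstar ** ?P')) + Mstar ** (?P' - mat 1)"
    by (simp add: K_def E_def C_def P_def matrix_mult.diff_right matrix_mult.diff_left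
        matrix_mult.add_right matrix_mult.minus_right matrix_mul_assoc algebra_simps)
  have "rank (Mstar + t *\<^sub>R E) \<le> 2 * CARD('r)"
    using rank_mixture_le[OF assms(4), where a = 1 and b = t and c = 0 and X = X]
    by (subst E_form) simp
  moreover have "rank (a *\<^sub>R E + b *\<^sub>R K) \<le> 2 * CARD('r)" for a b
    using rank_mixture_le[OF assms(4), where a = 0 and b = a and c = b and X = X]
    by (subst E_form, subst K_form) simp
  ultimately have rip:
    "(1 - \<delta>) * (norm (a *\<^sub>R E + b *\<^sub>R K))\<^sup>2 \<le> f'' (Mstar + t *\<^sub>R E) (a *\<^sub>R E + b *\<^sub>R K) (a *\<^sub>R E + b *\<^sub>R K)"
    "f'' (Mstar + t *\<^sub>R E) (a *\<^sub>R E + b *\<^sub>R K) (a *\<^sub>R E + b *\<^sub>R K) \<le> (1 + \<delta>) * (norm (a *\<^sub>R E + b *\<^sub>R K))\<^sup>2"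
    for a b
    using assms(10) unfolding restricted_isometry_def hessian_eq_second_derivative[OF f' f''] by blast+
  have "norm K * norm K \<le> (\<delta> * norm E) * norm K"
    using restricted_cosine_bound[OF zero zero' E_nz K_nz rip]
    by (simp add: EK power2_eq_square mult_ac)
  then have "norm K \<le> \<delta> * norm E" using K_nz by simp
  then show False using cos by simp
qed

end
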